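(* Let $n\ge 1$ and $h\ge 1$ be integers. There is a bijection between the set of Dyck paths of length $2n$ with a marked peak of height $h$ and the set of Dyck bridges of length $2n$ whose first step is $\mathtt d$ and which have exactly $h-1$ crossings of the $x$-axis. Consequently, the total number of peaks in all Dyck paths of length $2n$ equals $\binom{2n-1}{n}$.
   Context: Paths consist of steps $\mathtt u=(1,1)$ and $\mathtt d=(1,-1)$ and start at the origin. A Dyck path of length $2n$ is such a path of $2n$ steps that ends on the $x$-axis and never goes below the $x$-axis. A Dyck bridge of length $2n$ is such a path of $2n$ steps ending on the $x$-axis, with no other constraint (it may go below the $x$-axis). A peak is an occurrence of two consecutive steps $\mathtt u\mathtt d$; its height is the $y$-coordinate of the vertex between these two steps. A Dyck path with a marked peak is a Dyck path together with a distinguished one of its peaks (the same path with different marked peaks gives different objects). If $S_t$ denotes the height of the path after $t$ steps, a crossing of the $x$-axis is a time $t$ with $0<t<2n$, $S_t=0$ and $S_{t-1}S_{t+1}<0$ (i.e., the path passes from strictly one side of the $x$-axis to strictly the other side). *)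

theory Defs
  imports Main
begin

datatype step = U | D

fun step_val :: "step \<Rightarrow> int" where
  "step_val U = 1"
| "step_val D = - 1"

text \<open>A path is a list of steps starting at the origin; \<open>height w t\<close> is the
  \<open>y\<close>-coordinate after \<open>t\<close> steps, meaningful for \<open>t \<le> length w\<close>.\<close>

definition height :: "step list \<Rightarrow> nat \<Rightarrow> int" where
  "height w t = (\<Sum>s\<leftarrow>take t w. step_val s)"

definition dyck_bridges :: "nat \<Rightarrow> step list set" where
  "dyck_bridges n = {w. length w = 2 * n \<and> height w (2 * n) = 0}"

definition dyck_paths :: "nat \<Rightarrow> step list set" where
  "dyck_paths n = {w \<in> dyck_bridges n. \<forall>t \<le> 2 * n. height w t \<ge> 0}"

text \<open>A peak is identified by the time \<open>t\<close> of its top vertex: step number \<open>t\<close>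
  (list position \<open>t - 1\<close>) is an up step and the next one is a down step.
  The height of the peak is thus \<open>height w t\<close>.\<close>

definition peaks :: "step list \<Rightarrow> nat set" where
  "peaks w = {t. 0 < t \<and> t < length w \<and> w ! (t - 1) = U \<and> w ! t = D}"

definition marked_dyck_paths :: "nat \<Rightarrow> nat \<Rightarrow> (step list \<times> nat) set" where
  "marked_dyck_paths n h =
     {(w, t). w \<in> dyck_paths n \<and> t \<in> peaks w \<and> height w t = int h}"

definition crossings :: "step list \<Rightarrow> nat set" where
  "crossings w = {t. 0 < t \<and> t < length w \<and> height w t = 0 \<and>
     height w (t - 1) * height w (t + 1) < 0}"

definition down_bridges :: "nat \<Rightarrow> nat \<Rightarrow> step list set" where
  "down_bridges n k =
     {w \<in> dyck_bridges n. w \<noteq> [] \<and> hd w = D \<and> card (crossings w) = k}"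

end

theory Submission imports Defs begin

text \<open>Both kinds of objects encode a nonempty list of pairs \<open>(A\<^sub>i, B\<^sub>i)\<close> of Dyck words.
  Cutting a marked path at its peak and at the last passages before and the first passages after
  it at each lower height gives \<open>A\<^sub>h u \<dots> A\<^sub>1 u | d B\<^sub>1 \<dots> d B\<^sub>h\<close>, with one pair for each unit of
  height of the peak. Cutting a bridge at its crossings gives blocks alternately below and above
  the axis, and each block is, up to reflection, uniquely \<open>u A\<^sub>i d B\<^sub>i\<close>. So a list of \<open>h\<close> pairs
  corresponds to a peak of height \<open>h\<close> on one side and to \<open>h - 1\<close> crossings on the other. Summing over
  \<open>h\<close> counts all bridges with first step \<open>d\<close>.\<close>

section \<open>Dyck words\<close>

abbreviation wt :: "step list \<Rightarrow> int" where
  "wt w \<equiv> sum_list (map step_val w)"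

text \<open>\<open>t\<close> may exceed the length: \<open>take\<close> then returns the whole word,
  so the final height is covered too.\<close>

definition nonneg :: "step list \<Rightarrow> bool" where
  "nonneg w \<longleftrightarrow> (\<forall>t. 0 \<le> wt (take t w))"

definition dyck :: "step list \<Rightarrow> bool" where
  "dyck w \<longleftrightarrow> nonneg w \<and> wt w = 0"

definition begins :: "step \<Rightarrow> step list \<Rightarrow> bool" where
  "begins s w \<longleftrightarrow> w = [] \<or> hd w = s"

lemma begins_simps [simp]: "begins s []" "begins s (x # w) \<longleftrightarrow> x = s"
  by (auto simp: begins_def)

lemma height_wt: "height w t = wt (take t w)"
  by (simp add: height_def)

lemma nonneg_Nil [simp]: "nonneg []"
  by (simp add: nonneg_def)

lemma nonneg_wt: "nonneg w \<Longrightarrow> 0 \<le> wt w"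
  unfolding nonneg_def by (drule spec[of _ "length w"]) simp

lemma nonneg_prefix: "nonneg (x @ y) \<Longrightarrow> nonneg x"
  unfolding nonneg_def
proof
  fix t
  assume "\<forall>t. 0 \<le> wt (take t (x @ y))"
  moreover have "take t x = take (min t (length x)) (x @ y)" by (simp add: min_def)
  ultimately show "0 \<le> wt (take t x)" by metis
qed

lemma nonneg_append:
  assumes "nonneg x" "\<And>t. 0 \<le> wt x + wt (take t y)"
  shows "nonneg (x @ y)"
  unfolding nonneg_def
proof
  fix t
  show "0 \<le> wt (take t (x @ y))"
  proof (cases "t \<le> length x")
    case True
    then show ?thesis using assms(1) by (simp add: nonneg_def)
  next
    case False
    then show ?thesis using assms(2)[of "t - length x"] by simp
  qed
qed

lemma nonneg_snoc: "nonneg w \<Longrightarrow> 0 \<le> wt w + step_val x \<Longrightarrow> nonneg (w @ [x])"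
  by (rule nonneg_append) (auto simp: take_Cons' nonneg_wt)

text \<open>\<open>A\<close> is the part of \<open>v\<close> before the first step below the axis;
  such a step can only be a \<open>D\<close> taken at height 0. Induction from the right works
  because a cut, once it exists, survives further steps.\<close>

lemma first_descent:
  "\<exists>A r. v = A @ r \<and> nonneg A \<and> (r = [] \<or> hd r = D \<and> wt A = 0)"
proof (induction v rule: rev_induct)
  case Nil
  show ?case by simp
next
  case (snoc x v)
  then obtain A r where *: "v = A @ r" "nonneg A" "r = [] \<or> hd r = D \<and> wt A = 0"
    by blast
  show ?case
  proof (cases "r = []")
    case False
    then show ?thesis using * by (intro exI[of _ A] exI[of _ "r @ [x]"]) auto
  next
    case True
    then have v: "nonneg v" using * by simp
    show ?thesis
    proof (cases "0 \<le> wt v + step_val x")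
      case True
      then show ?thesis using nonneg_snoc[OF v]
        by (intro exI[of _ "v @ [x]"] exI[of _ "[]"]) simp
    next
      case False
      then have "x = D \<and> wt v = 0" using nonneg_wt[OF v] by (cases x) auto
      then show ?thesis using v by (intro exI[of _ v] exI[of _ "[x]"]) simp
    qed
  qed
qed

text \<open>A nonempty \<open>x\<close> would start with a \<open>D\<close> taken at height 0, so
  \<open>A @ x\<close> would reach height -1.\<close>

lemma dyck_prefix_unique_aux:
  assumes "dyck A" "dyck (A @ x)" "begins D (x @ r)"
  shows "x = []"
proof (rule ccontr)
  assume "x \<noteq> []"
  then obtain y where "x = D # y" using assms(3) by (cases x) auto
  then have "nonneg (A @ [D])"
    using assms(2) nonneg_prefix[of "A @ [D]" y] by (simp add: dyck_def)
  then show False using nonneg_wt[of "A @ [D]"] assms(1) by (simp add: dyck_def)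
qed

text \<open>Uniqueness of the cut made by \<open>first_descent\<close>; injectivity of both
  encodings rests on it.\<close>

lemma dyck_prefix_unique:
  assumes "dyck A" "dyck A'" "begins D r" "begins D r'" "A @ r = A' @ r'"
  shows "A = A' \<and> r = r'"
  using assms(5) unfolding append_eq_append_conv2
  using dyck_prefix_unique_aux assms(1-4) by fastforce

section \<open>Marked Dyck paths as lists of pairs\<close>

fun flip :: "step \<Rightarrow> step" where
  "flip U = D"
| "flip D = U"

lemma flip_flip [simp]: "flip (flip s) = s"
  by (cases s) auto

lemma map_flip_flip [simp]: "map flip (map flip w) = w"
  by (induction w) auto

lemma step_val_flip [simp]: "step_val (flip s) = - step_val s"
  by (cases s) auto

lemma wt_flip [simp]: "wt (map flip w) = - wt w"
  by (induction w) auto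

text \<open>Reflection in a vertical line: the path traversed backwards.\<close>

definition mirror :: "step list \<Rightarrow> step list" where
  "mirror w = map flip (rev w)"

lemma mirror_simps [simp]:
  "mirror (mirror w) = w" "length (mirror w) = length w" "wt (mirror w) = - wt w"
  "mirror [] = []"
  by (simp_all add: mirror_def rev_map [symmetric] del: map_map)

lemma mirror_inject: "mirror v = mirror w \<longleftrightarrow> v = w"
  by (metis mirror_simps(1))

text \<open>These are the paths that never go below their final height.\<close>

definition desc :: "step list \<Rightarrow> bool" where
  "desc w \<longleftrightarrow> nonneg (mirror w)"

lemma desc_iff: "desc w \<longleftrightarrow> (\<forall>t. wt (drop t w) \<le> 0)"
proof -
  \<comment> \<open>For \<open>t\<close> past the end, the truncated difference is 0 and both sides
    are \<open>mirror w\<close>.\<close>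
  have "take t (mirror w) = mirror (drop (length w - t) w)" for t
    by (simp add: mirror_def take_map take_rev)
  then have *: "wt (take t (mirror w)) = - wt (drop (length w - t) w)" for t
    by simp
  show ?thesis
  proof
    assume d: "desc w"
    show "\<forall>t. wt (drop t w) \<le> 0"
    proof
      fix t
      show "wt (drop t w) \<le> 0"
      proof (cases "t \<le> length w")
        case True
        then have "wt (drop t w) = - wt (take (length w - t) (mirror w))" by (simp add: *)
        then show ?thesis using d by (simp add: desc_def nonneg_def)
      qed simp
    qed
  next
    assume "\<forall>t. wt (drop t w) \<le> 0"
    then show "desc w" unfolding desc_def nonneg_def using * by simp
  qed
qed

lemma desc_suffix: "desc (x @ y) \<Longrightarrow> desc y"
  unfolding desc_def mirror_def by (auto intro: nonneg_prefix)

lemma desc_wt: "desc w \<Longrightarrow> wt w \<le> 0"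
  unfolding desc_def using nonneg_wt by fastforce

lemma dyck_desc:
  assumes "dyck w"
  shows "desc w"
  unfolding desc_iff
proof
  fix t
  have "wt (take t w) + wt (drop t w) = wt w"
    by (metis append_take_drop_id map_append sum_list.append)
  then show "wt (drop t w) \<le> 0"
    using assms by (simp add: dyck_def nonneg_def) (smt (verit))
qed

lemma desc_append: "desc x \<Longrightarrow> desc y \<Longrightarrow> desc (x @ y)"
  by (simp add: desc_iff add_nonpos_nonpos)

text \<open>When the words are Dyck, the displayed \<open>D\<close> steps are the first passages to
  the levels -1, -2, and so on.\<close>

fun chain :: "step list list \<Rightarrow> step list" where
  "chain [] = []"
| "chain (B # Bs) = D # B @ chain Bs"

lemma begins_chain: "begins D (chain Bs)"
  by (cases Bs) auto

lemma wt_chain: "\<forall>B\<in>set Bs. dyck B \<Longrightarrow> wt (chain Bs) = - int (length Bs)"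
  by (induction Bs) (auto simp: dyck_def)

lemma desc_chain: "\<forall>B\<in>set Bs. dyck B \<Longrightarrow> desc (chain Bs)"
proof (induction Bs)
  case Nil
  then show ?case by (simp add: desc_def)
next
  case (Cons B Bs)
  have "desc [D]" by (simp add: desc_iff drop_Cons')
  then have "desc ([D] @ (B @ chain Bs))"
    using Cons by (intro desc_append) (auto intro: dyck_desc)
  then show ?case by simp
qed

lemma chain_inject:
  "\<forall>B\<in>set Bs. dyck B \<Longrightarrow> \<forall>C\<in>set Cs. dyck C \<Longrightarrow> chain Bs = chain Cs \<Longrightarrow> Bs = Cs"
proof (induction Bs arbitrary: Cs)
  case Nil
  then show ?case by (cases Cs) auto
next
  case (Cons B Bs)
  then obtain C Cs' where Cs: "Cs = C # Cs'" by (cases Cs) auto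
  have "B = C \<and> chain Bs = chain Cs'"
    using Cons.prems Cs by (intro dyck_prefix_unique begins_chain) auto
  moreover from this have "Bs = Cs'"
    using Cons.prems Cs by (intro Cons.IH) simp_all
  ultimately show ?case using Cs by simp
qed

text \<open>After the initial \<open>D\<close>, \<open>first_descent\<close> isolates the Dyck word
  before the next new minimum; what remains is again of the same kind.\<close>

lemma chain_surj:
  "desc w \<Longrightarrow> begins D w \<Longrightarrow> \<exists>Bs. (\<forall>B\<in>set Bs. dyck B) \<and> chain Bs = w"
proof (induction w rule: length_induct)
  case (1 w)
  show ?case
  proof (cases w)
    case Nil
    then show ?thesis by (intro exI[of _ "[]"]) simp
  next
    case (Cons s v)
    then have w: "w = [D] @ v" using "1.prems" by simp
    obtain B r where B: "v = B @ r" "nonneg B" "r = [] \<or> hd r = D \<and> wt B = 0"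
      using first_descent by blast
    have v: "desc v" using "1.prems" w desc_suffix by blast
    then have r: "desc r" using B desc_suffix by blast
    \<comment> \<open>If \<open>r\<close> is empty then \<open>B\<close> is all of \<open>v\<close>,
      whose weight is nonnegative by the cut and nonpositive by \<open>desc v\<close>.\<close>
    have "dyck B" using B nonneg_wt[of B] desc_wt[OF v] by (auto simp: dyck_def)
    moreover have "begins D r" using B by (auto simp: begins_def)
    moreover have "length r < length w" using w B by simp
    ultimately obtain Bs where "\<forall>B\<in>set Bs. dyck B" "chain Bs = r"
      using r "1.IH" by blast
    with \<open>dyck B\<close> show ?thesis using w B by (intro exI[of _ "B # Bs"]) simp
  qed
qed

text \<open>The ascent to the peak, read backwards, is a chain as well. Hence the first components
  occur mirrored in the path, and the mark sits where the ascent ends.\<close>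

definition mark :: "(step list \<times> step list) list \<Rightarrow> step list \<times> nat" where
  "mark L = (mirror (chain (map fst L)) @ chain (map snd L), length (chain (map fst L)))"

definition dyck_pairs :: "(step list \<times> step list) list set" where
  "dyck_pairs = {L. L \<noteq> [] \<and> (\<forall>(A, B)\<in>set L. dyck A \<and> dyck B)}"

lemma dyck_pairs_components:
  assumes "L \<in> dyck_pairs"
  shows "\<forall>A\<in>set (map fst L). dyck A" "\<forall>B\<in>set (map snd L). dyck B"
  using assms by (auto simp: dyck_pairs_def)

lemma dyck_paths_iff: "w \<in> dyck_paths n \<longleftrightarrow> length w = 2 * n \<and> dyck w"
proof -
  have "nonneg w \<longleftrightarrow> (\<forall>t\<le>length w. 0 \<le> wt (take t w))"
    unfolding nonneg_def by (metis nat_le_linear order_refl take_all)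
  then show ?thesis
    by (auto simp: dyck_paths_def dyck_bridges_def dyck_def height_wt)
qed

text \<open>The right half never goes below its final height, which is 0 because the two chains have
  equally many blocks.\<close>

lemma mark_dyck:
  assumes "L \<in> dyck_pairs"
  shows "dyck (fst (mark L))"
proof -
  let ?x = "chain (map fst L)" and ?y = "chain (map snd L)"
  note L = dyck_pairs_components[OF assms]
  have x: "nonneg (mirror ?x)" using desc_chain[OF L(1)] by (simp add: desc_def)
  have y: "wt (drop t ?y) \<le> 0" for t using desc_chain[OF L(2)] by (simp add: desc_iff)
  have xy: "wt (mirror ?x) + wt ?y = 0" using wt_chain[OF L(1)] wt_chain[OF L(2)] by simp
  have "0 \<le> wt (mirror ?x) + wt (take t ?y)" for t
  proof -
    have "wt (take t ?y) + wt (drop t ?y) = wt ?y"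
      by (metis append_take_drop_id map_append sum_list.append)
    then show ?thesis using xy y[of t] by linarith
  qed
  then show ?thesis using nonneg_append[OF x] xy by (simp add: dyck_def mark_def)
qed

lemma mark_height:
  assumes "L \<in> dyck_pairs"
  shows "height (fst (mark L)) (snd (mark L)) = int (length L)"
  using wt_chain[OF dyck_pairs_components(1)[OF assms]] by (simp add: height_wt mark_def)

lemma peaks_append_iff:
  assumes "length x = t"
  shows "t \<in> peaks (x @ y) \<longleftrightarrow> x \<noteq> [] \<and> y \<noteq> [] \<and> last x = U \<and> hd y = D"
  using assms by (cases x rule: rev_cases; cases y) (auto simp: peaks_def nth_append)

lemma last_mirror: "w \<noteq> [] \<Longrightarrow> last (mirror w) = flip (hd w)"
  by (simp add: mirror_def last_map last_rev)

lemma mirror_eq_Nil [simp]: "mirror w = [] \<longleftrightarrow> w = []"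
  by (simp add: mirror_def)

lemma mark_peak:
  assumes "L \<in> dyck_pairs"
  shows "snd (mark L) \<in> peaks (fst (mark L))"
proof -
  obtain p L' where "L = p # L'" using assms by (cases L) (auto simp: dyck_pairs_def)
  then show ?thesis by (simp add: mark_def peaks_append_iff last_mirror)
qed

lemma inj_on_mark: "inj_on mark dyck_pairs"
proof (rule inj_onI)
  fix L M
  assume L: "L \<in> dyck_pairs" and M: "M \<in> dyck_pairs" and eq: "mark L = mark M"
  then have "chain (map fst L) = chain (map fst M)" "chain (map snd L) = chain (map snd M)"
    by (auto simp: mark_def mirror_inject)
  then have "map fst L = map fst M" "map snd L = map snd M"
    using dyck_pairs_components[OF L] dyck_pairs_components[OF M] chain_inject by blast+
  then show "L = M" by (metis zip_map_fst_snd)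
qed

text \<open>Cut at the peak. The left part read backwards and the right part both start with
  \<open>D\<close> and never go below their final height, so both are chains. Their weights agree,
  hence so do their numbers of blocks, and \<open>zip\<close> loses nothing.\<close>

lemma mark_surj:
  assumes "dyck w" "t \<in> peaks w"
  shows "(w, t) \<in> mark ` dyck_pairs"
proof -
  define x y where "x = mirror (take t w)" and "y = drop t w"
  have t: "t < length w" using assms(2) by (simp add: peaks_def)
  have w: "w = mirror x @ y" and len: "length x = t" using t by (auto simp: x_def y_def)
  have xy: "x \<noteq> []" "y \<noteq> []" "last (mirror x) = U" "hd y = D"
    using assms(2) len unfolding w by (auto simp: peaks_append_iff)
  have "hd x = D" using xy last_mirror[of x] by (cases "hd x") auto
  moreover have "desc x"
    using assms(1) nonneg_prefix[of "mirror x" y] w by (simp add: dyck_def desc_def)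
  moreover have "desc y" using dyck_desc[OF assms(1)] w desc_suffix by blast
  ultimately obtain As Bs where As: "\<forall>A\<in>set As. dyck A" "chain As = x"
    and Bs: "\<forall>B\<in>set Bs. dyck B" "chain Bs = y"
    using chain_surj xy by (metis begins_def)
  have "wt x = wt y" using assms(1) w by (simp add: dyck_def)
  then have eq: "length As = length Bs" using wt_chain[OF As(1)] wt_chain[OF Bs(1)] As Bs by simp
  have "As \<noteq> []" using As xy by auto
  then have "zip As Bs \<in> dyck_pairs"
    using As Bs eq by (auto simp: dyck_pairs_def dest: set_zip_leftD set_zip_rightD)
  moreover have "mark (zip As Bs) = (w, t)"
    using eq As Bs w len by (simp add: mark_def)
  ultimately show ?thesis by force
qed

section \<open>Bridges as lists of pairs\<close>

text \<open>Reflecting the whole tail at each call makes the blocks alternate between the two sides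
  without a sign parameter. The first block lies above the axis, so bridges starting with
  \<open>D\<close> need one more reflection.\<close>

fun arches :: "(step list \<times> step list) list \<Rightarrow> step list" where
  "arches [] = []"
| "arches ((A, B) # L) = U # A @ D # B @ map flip (arches L)"

lemma begins_flip [simp]: "begins s (map flip w) \<longleftrightarrow> begins (flip s) w"
  by (cases w; cases s; cases "hd w") auto

lemma begins_arches: "begins U (arches L)"
  by (cases L rule: arches.cases) auto

lemma arches_eq_Nil [simp]: "arches L = [] \<longleftrightarrow> L = []"
  by (cases L rule: arches.cases) auto

lemma wt_arches: "\<forall>(A, B)\<in>set L. dyck A \<and> dyck B \<Longrightarrow> wt (arches L) = 0"
  by (induction L rule: arches.induct) (auto simp: dyck_def simp del: map_map)

text \<open>Each pair contributes its two words and two further steps to either encoding, so a list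
  of pairs yields a path and a bridge of the same length.\<close>

lemma length_arches: "length (arches L) = length (fst (mark L))"
  by (induction L rule: arches.induct) (auto simp: mark_def)

lemma map_flip_inject: "map flip v = map flip w \<longleftrightarrow> v = w"
  by (metis map_flip_flip)

text \<open>Two unique cuts recover the first pair: \<open>A\<close> is followed by
  \<open>D\<close>, and \<open>B\<close> by a reflected tail that is empty or starts with
  \<open>D\<close>.\<close>

lemma arches_inject:
  "\<forall>(A, B)\<in>set L. dyck A \<and> dyck B \<Longrightarrow> \<forall>(A, B)\<in>set M. dyck A \<and> dyck B \<Longrightarrow>
    arches L = arches M \<Longrightarrow> L = M"
proof (induction L arbitrary: M rule: arches.induct)
  case 1
  then show ?case by (metis arches_eq_Nil)
next
  case (2 A B L)
  then obtain A' B' M' where M: "M = (A', B') # M'" by (cases M rule: arches.cases) auto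
  have "A = A' \<and> D # B @ map flip (arches L) = D # B' @ map flip (arches M')"
    using "2.prems" M by (intro dyck_prefix_unique) auto
  then have A: "A = A'" and *: "B @ map flip (arches L) = B' @ map flip (arches M')" by auto
  have "B = B' \<and> map flip (arches L) = map flip (arches M')"
    using "2.prems" M * by (intro dyck_prefix_unique) (auto simp: begins_arches)
  then show ?case using A M 2 by (auto simp: map_flip_inject)
qed

lemma arches_surj:
  "wt w = 0 \<Longrightarrow> begins U w \<Longrightarrow> \<exists>L. (\<forall>(A, B)\<in>set L. dyck A \<and> dyck B) \<and> arches L = w"
proof (induction w rule: length_induct)
  case (1 w)
  show ?case
  proof (cases w)
    case Nil
    then show ?thesis by (intro exI[of _ "[]"]) simp
  next
    case (Cons s v)
    then have w: "w = U # v" using "1.prems" by simp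
    obtain A r where A: "v = A @ r" "nonneg A" "r = [] \<or> hd r = D \<and> wt A = 0"
      using first_descent by blast
    \<comment> \<open>As \<open>v\<close> ends below its start, the cut must stop at a
      \<open>D\<close>: the first return of \<open>w\<close> to the axis.\<close>
    have "wt v < 0" using w "1.prems" by simp
    then obtain u where r: "r = D # u" and "dyck A"
      using A nonneg_wt[of A] by (cases r) (auto simp: dyck_def)
    then have u: "wt u = 0" using A w "1.prems" by (simp add: dyck_def)
    \<comment> \<open>This second cut falls at the first crossing of \<open>w\<close>, or at its end
      if there is none. Reflecting \<open>q\<close> makes the induction hypothesis
      applicable.\<close>
    obtain B q where B: "u = B @ q" "nonneg B" "q = [] \<or> hd q = D \<and> wt B = 0"
      using first_descent by blast
    have "dyck B" using B u by (auto simp: dyck_def)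
    then have "wt (map flip q) = 0" using B u by (simp add: dyck_def del: map_map)
    moreover have "begins U (map flip q)" using B by (cases q) auto
    moreover have "length (map flip q) < length w" using w A r B by simp
    ultimately obtain L where "\<forall>(A, B)\<in>set L. dyck A \<and> dyck B" "arches L = map flip q"
      using "1.IH" by blast
    with \<open>dyck A\<close> \<open>dyck B\<close> show ?thesis using w A r B
      by (intro exI[of _ "(A, B) # L"]) (simp del: map_map)
  qed
qed

section \<open>Crossings of the axis\<close>

lemma crossings_flip [simp]: "crossings (map flip w) = crossings w"
  by (simp add: crossings_def height_wt take_map del: map_map)

text \<open>Before the end of \<open>P\<close> no height is negative, at its end the path passes
  from 1 to -1, and from there on the heights are those of \<open>r\<close>, shifted in
  time.\<close>

lemma crossings_block:
  assumes "dyck P" "P \<noteq> []" "r \<noteq> []" "hd r = D"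
  shows "crossings (P @ r) = insert (length P) ((+) (length P) ` crossings r)"
proof -
  have below: "0 \<le> height (P @ r) t" if "t \<le> length P" for t
    using that assms(1) by (simp add: height_wt dyck_def nonneg_def)
  have above: "height (P @ r) (length P + s) = height r s" for s
    using assms(1) by (simp add: height_wt dyck_def)
  obtain r' where r: "r = D # r'" using assms by (cases r) auto
  have low: "height (P @ r) (length P + 1) = - 1"
    using above[of 1] r by (simp add: height_wt)
  \<comment> \<open>The last step of \<open>P\<close> arrives at 0 from a nonnegative height, hence
    from 1.\<close>
  have high: "height (P @ r) (length P - 1) = 1"
  proof -
    obtain Q s where P: "P = Q @ [s]" using assms(2) by (cases P rule: rev_cases) auto
    then have "0 \<le> wt Q" "wt Q + step_val s = 0"
      using assms(1) by (auto simp: dyck_def dest: nonneg_prefix nonneg_wt)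
    then show ?thesis using P by (cases s) (auto simp: height_wt)
  qed
  show ?thesis
  proof (intro equalityI subsetI)
    fix t
    assume t: "t \<in> crossings (P @ r)"
    show "t \<in> insert (length P) ((+) (length P) ` crossings r)"
    proof (cases t "length P" rule: linorder_cases)
      case less
      then have "0 \<le> height (P @ r) (t - 1) * height (P @ r) (t + 1)"
        using below by simp
      then show ?thesis using t by (simp add: crossings_def)
    next
      case equal
      then show ?thesis by simp
    next
      case greater
      define s where "s = t - length P"
      \<comment> \<open>Positivity of \<open>s\<close> ensures that \<open>t - 1\<close> is
        \<open>length P + (s - 1)\<close> despite truncated subtraction.\<close>
      have s: "t = length P + s" "0 < s" using greater by (auto simp: s_def)
      then have "s \<in> crossings r"
        using t above[of s] above[of "s + 1"] above[of "s - 1"] by (simp add: crossings_def)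
      then show ?thesis using s by blast
    qed
  next
    fix t
    assume "t \<in> insert (length P) ((+) (length P) ` crossings r)"
    then show "t \<in> crossings (P @ r)"
    proof (elim insertE imageE)
      assume "t = length P"
      then show ?thesis using above[of 0] low high assms(2,3)
        by (simp add: crossings_def height_wt)
    next
      fix s
      assume s: "t = length P + s" "s \<in> crossings r"
      then have "0 < s" by (simp add: crossings_def)
      then show ?thesis
        using s above[of s] above[of "s + 1"] above[of "s - 1"] by (simp add: crossings_def)
    qed
  qed
qed

lemma crossings_dyck:
  assumes "dyck P"
  shows "crossings P = {}"
proof -
  have "0 \<le> height P t" for t using assms by (simp add: height_wt dyck_def nonneg_def)
  then show ?thesis by (auto simp: crossings_def not_less)
qed

lemma finite_crossings: "finite (crossings w)"
  by (rule finite_subset[of _ "{..<length w}"]) (auto simp: crossings_def)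

lemma dyck_arch:
  assumes "dyck A" "dyck B"
  shows "dyck (U # A @ D # B)"
proof -
  have "0 \<le> wt (take t A)" "0 \<le> wt (take t B)" "wt A = 0" "wt B = 0" for t
    using assms by (auto simp: dyck_def nonneg_def)
  then have "0 \<le> wt (take t (U # A @ D # B))" for t
    \<comment> \<open>The difference is 0 exactly when the prefix ends within \<open>U # A\<close>;
      otherwise it contains the middle \<open>D\<close>.\<close>
    by (cases t; cases "t - 1 - length A") (auto simp: take_Cons' add_nonneg_nonneg)
  then show ?thesis using assms by (simp add: dyck_def nonneg_def)
qed

text \<open>Every block but the last contributes one crossing, at its end, and reflecting the tail
  preserves crossings. For the empty list, truncated subtraction gives 0.\<close>

lemma card_crossings_arches:
  "\<forall>(A, B)\<in>set L. dyck A \<and> dyck B \<Longrightarrow> card (crossings (arches L)) = length L - 1"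
proof (induction L rule: arches.induct)
  case 1
  then show ?case by (simp add: crossings_def)
next
  case (2 A B L)
  let ?P = "U # A @ D # B" and ?r = "map flip (arches L)"
  have P: "dyck ?P" using "2.prems" by (auto intro: dyck_arch)
  show ?case
  proof (cases "L = []")
    case True
    then show ?thesis using crossings_dyck[OF P] by simp
  next
    case False
    then have r: "?r \<noteq> []" by simp
    then have "hd ?r = D" using begins_arches[of L] by (simp add: begins_def hd_map)
    then have "crossings (?P @ ?r) = insert (length ?P) ((+) (length ?P) ` crossings (arches L))"
      using crossings_block[OF P _ r] by simp
    \<comment> \<open>Crossing times are positive, so the shifted ones lie strictly beyond
      \<open>length ?P\<close>.\<close>
    moreover have "length ?P \<notin> (+) (length ?P) ` crossings (arches L)"
      by (auto simp: crossings_def)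
    moreover have "card ((+) (length ?P) ` crossings (arches L)) = length L - 1"
      using 2 by (subst card_image) auto
    ultimately have "card (crossings (?P @ ?r)) = Suc (length L - 1)"
      by (simp add: finite_crossings)
    then show ?thesis using False by simp
  qed
qed

section \<open>Counting\<close>

lemma finite_words: "finite {w :: step list. length w = m}"
proof -
  have "(UNIV :: step set) = {U, D}" using step.exhaust by auto
  then have "finite (UNIV :: step set)" by (rule ssubst) simp
  from finite_lists_length_eq[OF this, of m] show ?thesis by simp
qed

lemma card_words: "card {w. length w = m \<and> count_list w U = k} = m choose k"
proof (induction m arbitrary: k)
  case 0
  have "{w. length w = 0 \<and> count_list w U = k} = (if k = 0 then {[]} else {})" by auto
  then show ?case by (cases k) auto
next
  case (Suc m)
  let ?W = "\<lambda>m k. {w. length w = m \<and> count_list w U = k}"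
  have fin: "finite (?W m k)" for m k
    by (rule finite_subset[OF _ finite_words[of m]]) auto
  \<comment> \<open>Pascal's rule by first letter: a leading \<open>U\<close> uses up one of the
    \<open>k\<close> up steps, which is impossible for \<open>k = 0\<close>.\<close>
  have mem: "w \<in> ?W (Suc m) k \<longleftrightarrow>
      w \<in> (#) D ` ?W m k \<or> (\<exists>j. k = Suc j \<and> w \<in> (#) U ` ?W m j)" for w
  proof (cases w)
    case (Cons s v)
    then show ?thesis by (cases s; cases k) auto
  qed auto
  show ?case
  proof (cases k)
    case 0
    then have "?W (Suc m) k = (#) D ` ?W m k"
      by (intro set_eqI, subst mem) simp
    then show ?thesis using Suc 0 by (simp add: card_image)
  next
    case (Suc j)
    then have "?W (Suc m) k = (#) D ` ?W m k \<union> (#) U ` ?W m j"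
      by (intro set_eqI, subst mem) auto
    also have "card \<dots> = card (?W m k) + card (?W m j)"
      by (subst card_Un_disjoint) (auto simp: card_image fin)
    finally show ?thesis using Suc.IH Suc by simp
  qed
qed

lemma wt_count: "wt w = 2 * int (count_list w U) - int (length w)"
proof (induction w)
  case (Cons s w)
  then show ?case by (cases s) auto
qed simp

text \<open>After the initial \<open>D\<close>, the remaining \<open>2 * n - 1\<close> steps must
  have weight 1, which means exactly \<open>n\<close> up steps.\<close>

lemma card_bridges_D:
  assumes "n \<ge> 1"
  shows "card {w \<in> dyck_bridges n. w \<noteq> [] \<and> hd w = D} = (2 * n - 1) choose n"
proof -
  have "{w \<in> dyck_bridges n. w \<noteq> [] \<and> hd w = D}
      = (#) D ` {w. length w = 2 * n - 1 \<and> count_list w U = n}" (is "?L = ?R")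
  proof (intro equalityI subsetI)
    fix w assume w: "w \<in> ?L"
    then obtain v where "w = D # v" by (cases w) auto
    then show "w \<in> ?R" using w wt_count[of v]
      by (auto simp: dyck_bridges_def height_wt)
  next
    fix w assume "w \<in> ?R"
    then obtain v where "w = D # v" "length v = 2 * n - 1" "count_list v U = n" by auto
    then show "w \<in> ?L" using assms wt_count[of v]
      by (auto simp: dyck_bridges_def height_wt)
  qed
  then show ?thesis by (simp add: card_image card_words)
qed

text \<open>All peak heights are treated at once: restricting to one height serves the bijection,
  and taking cardinalities serves the count.\<close>

lemma bij_betw_mark:
  "bij_betw mark {L \<in> dyck_pairs. length (arches L) = 2 * n} (SIGMA w:dyck_paths n. peaks w)"
  unfolding bij_betw_def
proof
  show "inj_on mark {L \<in> dyck_pairs. length (arches L) = 2 * n}"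
    using inj_on_mark by (rule inj_on_subset) auto
  show "mark ` {L \<in> dyck_pairs. length (arches L) = 2 * n} = (SIGMA w:dyck_paths n. peaks w)"
  proof (intro equalityI subsetI)
    fix z assume "z \<in> mark ` {L \<in> dyck_pairs. length (arches L) = 2 * n}"
    then obtain L where L: "L \<in> dyck_pairs" "length (arches L) = 2 * n" "z = mark L" by auto
    then show "z \<in> (SIGMA w:dyck_paths n. peaks w)"
      using mark_dyck[OF L(1)] mark_peak[OF L(1)]
      by (cases "mark L") (simp add: dyck_paths_iff length_arches)
  next
    fix z assume "z \<in> (SIGMA w:dyck_paths n. peaks w)"
    then obtain w t where z: "z = (w, t)" "length w = 2 * n" "dyck w" "t \<in> peaks w"
      by (auto simp: dyck_paths_iff)
    then obtain L where "L \<in> dyck_pairs" "mark L = (w, t)" using mark_surj by force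
    then show "z \<in> mark ` {L \<in> dyck_pairs. length (arches L) = 2 * n}"
      using z by (force simp: length_arches)
  qed
qed

lemma bij_betw_arches:
  "bij_betw (\<lambda>L. map flip (arches L)) {L \<in> dyck_pairs. length (arches L) = 2 * n}
    {w \<in> dyck_bridges n. w \<noteq> [] \<and> hd w = D}"
  unfolding bij_betw_def
proof
  show "inj_on (\<lambda>L. map flip (arches L)) {L \<in> dyck_pairs. length (arches L) = 2 * n}"
    by (rule inj_onI) (auto simp: map_flip_inject dyck_pairs_def intro: arches_inject)
  show "(\<lambda>L. map flip (arches L)) ` {L \<in> dyck_pairs. length (arches L) = 2 * n}
      = {w \<in> dyck_bridges n. w \<noteq> [] \<and> hd w = D}" (is "?L = ?R")
  proof (intro equalityI subsetI)
    fix w assume "w \<in> ?L"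
    then obtain L where L: "L \<in> dyck_pairs" "length (arches L) = 2 * n" "w = map flip (arches L)"
      by auto
    have "hd (arches L) = U" "arches L \<noteq> []"
      using begins_arches[of L] L(1) by (auto simp: begins_def dyck_pairs_def)
    then show "w \<in> ?R" using L wt_arches[of L]
      by (simp add: dyck_pairs_def dyck_bridges_def height_wt hd_map del: map_map)
  next
    fix w assume w: "w \<in> ?R"
    then have "wt (map flip w) = 0" "begins U (map flip w)" "length w = 2 * n" "w \<noteq> []"
      by (auto simp: dyck_bridges_def height_wt begins_def hd_map simp del: map_map)
    then obtain L where L: "\<forall>(A, B)\<in>set L. dyck A \<and> dyck B" "arches L = map flip w"
      using arches_surj by blast
    then have "w = map flip (arches L)" by (simp del: map_map)
    moreover have "L \<in> dyck_pairs" using L \<open>w \<noteq> []\<close> by (auto simp: dyck_pairs_def)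
    ultimately show "w \<in> ?L" using \<open>length w = 2 * n\<close> by auto
  qed
qed

text \<open>Used to restrict both encodings to lists of length \<open>h\<close>, as that length
  determines peak height and number of crossings.\<close>

lemma bij_betw_restrict:
  assumes "bij_betw f A B" "\<And>x. x \<in> A \<Longrightarrow> Q (f x) \<longleftrightarrow> P x"
  shows "bij_betw f {x \<in> A. P x} {y \<in> B. Q y}"
  using assms unfolding bij_betw_def by (auto intro: inj_on_subset)

theorem theorem3p1:
  fixes n h :: nat
  assumes "n \<ge> 1" and "h \<ge> 1"
  shows "(\<exists>f. bij_betw f (marked_dyck_paths n h) (down_bridges n (h - 1))) \<and>
         (\<Sum>w\<in>dyck_paths n. card (peaks w)) = (2 * n - 1) choose n"
proof
  let ?S = "{L \<in> dyck_pairs. length (arches L) = 2 * n}"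
  have "bij_betw mark {L \<in> ?S. length L = h}
      {z \<in> SIGMA w:dyck_paths n. peaks w. height (fst z) (snd z) = int h}"
    by (rule bij_betw_restrict[OF bij_betw_mark]) (simp add: mark_height)
  moreover have "{z \<in> SIGMA w:dyck_paths n. peaks w. height (fst z) (snd z) = int h}
      = marked_dyck_paths n h"
    by (auto simp: marked_dyck_paths_def)
  ultimately have "bij_betw mark {L \<in> ?S. length L = h} (marked_dyck_paths n h)"
    by simp
  moreover have "bij_betw (\<lambda>L. map flip (arches L)) {L \<in> ?S. length L = h}
      (down_bridges n (h - 1))"
  proof -
    have "card (crossings (map flip (arches L))) = h - 1 \<longleftrightarrow> length L = h" if "L \<in> ?S" for L
    proof -
      \<comment> \<open>Positivity of both \<open>length L\<close> and \<open>h\<close> lets the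
        truncated \<open>length L - 1 = h - 1\<close> imply \<open>length L = h\<close>.\<close>
      have "0 < length L" "card (crossings (arches L)) = length L - 1"
        using that card_crossings_arches[of L] by (simp_all add: dyck_pairs_def)
      then show ?thesis using assms(2) unfolding crossings_flip by linarith
    qed
    then have "bij_betw (\<lambda>L. map flip (arches L)) {L \<in> ?S. length L = h}
        {w \<in> {w \<in> dyck_bridges n. w \<noteq> [] \<and> hd w = D}. card (crossings w) = h - 1}"
      by (rule bij_betw_restrict[OF bij_betw_arches])
    moreover have "{w \<in> {w \<in> dyck_bridges n. w \<noteq> [] \<and> hd w = D}. card (crossings w) = h - 1}
        = down_bridges n (h - 1)"
      by (auto simp: down_bridges_def)
    ultimately show ?thesis by simp
  qed
  \<comment> \<open>The bijection is the inverse of \<open>mark\<close> followed by the bridge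
    encoding.\<close>
  ultimately show "\<exists>f. bij_betw f (marked_dyck_paths n h) (down_bridges n (h - 1))"
    using bij_betw_inv_into bij_betw_trans by blast
next
  have "finite (dyck_paths n)"
    by (rule finite_subset[OF _ finite_words[of "2 * n"]]) (auto simp: dyck_paths_iff)
  moreover have "finite (peaks w)" for w
    by (rule finite_subset[of _ "{..<length w}"]) (auto simp: peaks_def)
  ultimately have "(\<Sum>w\<in>dyck_paths n. card (peaks w)) = card (SIGMA w:dyck_paths n. peaks w)"
    by (simp add: card_SigmaI)
  \<comment> \<open>Both sets are in bijection with the same lists of pairs, now of every
    length.\<close>
  also have "\<dots> = card {w \<in> dyck_bridges n. w \<noteq> [] \<and> hd w = D}"
    using bij_betw_same_card[OF bij_betw_mark] bij_betw_same_card[OF bij_betw_arches] by metis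
  also have "\<dots> = (2 * n - 1) choose n"
    by (rule card_bridges_D[OF assms(1)])
  finally show "(\<Sum>w\<in>dyck_paths n. card (peaks w)) = (2 * n - 1) choose n" .
qed

end
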